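(* Let $n\geq 3$ be an odd integer. Then $\chi_{la}(K_{1,n,n})=3$.
   Context: All graphs are simple and finite. Let $G=(V,E)$ be a graph without isolated vertices. For a bijection $f:E\to\{1,2,\dots,|E|\}$ and a vertex $u$, the weight of $u$ is $w(u)=\sum_{e\in E(u)}f(e)$, where $E(u)$ is the set of edges incident to $u$. The bijection $f$ is a local antimagic labeling of $G$ if $w(u)\neq w(v)$ for every edge $uv\in E$; it then induces a proper vertex coloring of $G$ in which $v$ gets color $w(v)$. The local antimagic chromatic number $\chi_{la}(G)$ is the minimum number of distinct colors (distinct values of $w$) over all local antimagic labelings of $G$. $K_{1,n,n}$ is the complete tripartite graph with parts of sizes $1$, $n$ and $n$. *)

theory Defs
  imports "HOL-Library.Extended_Nat"
begin

text \<open>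
  A graph is given by its vertex set and its set of edges, an edge being the set of its two ends.
\<close>

record 'a ugraph =
  vertices :: "'a set"
  edges :: "'a set set"

definition simple_graph :: "'a ugraph \<Rightarrow> bool" where
  "simple_graph G \<longleftrightarrow> finite (vertices G) \<and> (\<forall>e\<in>edges G. e \<subseteq> vertices G \<and> card e = 2)"

definition incident_edges :: "'a ugraph \<Rightarrow> 'a \<Rightarrow> 'a set set" where
  "incident_edges G u = {e \<in> edges G. u \<in> e}"

definition no_isolated_vertices :: "'a ugraph \<Rightarrow> bool" where
  "no_isolated_vertices G \<longleftrightarrow> (\<forall>u\<in>vertices G. incident_edges G u \<noteq> {})"

definition weight :: "'a ugraph \<Rightarrow> ('a set \<Rightarrow> nat) \<Rightarrow> 'a \<Rightarrow> nat" where
  "weight G f u = (\<Sum>e\<in>incident_edges G u. f e)"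

definition local_antimagic_labeling :: "'a ugraph \<Rightarrow> ('a set \<Rightarrow> nat) \<Rightarrow> bool" where
  "local_antimagic_labeling G f \<longleftrightarrow>
     bij_betw f (edges G) {1..card (edges G)} \<and>
     (\<forall>u v. {u, v} \<in> edges G \<longrightarrow> weight G f u \<noteq> weight G f v)"

text \<open>
  The minimum is taken in \<^typ>\<open>enat\<close>: it is attained as soon as a local antimagic labeling
  exists, and is \<open>\<infinity>\<close> for a graph without one. A finite value therefore
  includes the existence of a labeling.
\<close>

definition local_antimagic_chromatic_number :: "'a ugraph \<Rightarrow> enat" where
  "local_antimagic_chromatic_number G =
     (INF f\<in>{f. local_antimagic_labeling G f}. enat (card (weight G f ` vertices G)))"

text \<open>
  The vertex \<open>(i, j)\<close> is the \<open>j\<close>-th element of the \<open>i\<close>-th part; the parts have the sizes listed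
  in \<open>ns\<close>.
\<close>

definition complete_multipartite :: "nat list \<Rightarrow> (nat \<times> nat) ugraph" where
  "complete_multipartite ns =
     (let V = {(i, j). i < length ns \<and> j < ns ! i} in
      \<lparr>vertices = V, edges = {{u, v} | u v. u \<in> V \<and> v \<in> V \<and> fst u \<noteq> fst v}\<rparr>)"

lemma simple_graph_complete_multipartite: "simple_graph (complete_multipartite ns)"
proof -
  have "{(i, j). i < length ns \<and> j < ns ! i} = (SIGMA i:{..<length ns}. {..<ns ! i})"
    by auto
  then show ?thesis
    by (auto simp: simple_graph_def complete_multipartite_def Let_def card_2_iff)
qed

lemma no_isolated_vertices_complete_tripartite:
  assumes "n \<ge> 1"
  shows "no_isolated_vertices (complete_multipartite [1, n, n])"
  unfolding no_isolated_vertices_def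
proof
  fix u assume u: "u \<in> vertices (complete_multipartite [1, n, n])"
  define v :: "nat \<times> nat" where "v = (if fst u = 0 then (1, 0) else (0, 0))"
  have "v \<in> vertices (complete_multipartite [1, n, n])" "fst u \<noteq> fst v"
    using assms by (auto simp: v_def complete_multipartite_def Let_def)
  with u have "{u, v} \<in> edges (complete_multipartite [1, n, n])"
    unfolding complete_multipartite_def Let_def ugraph.simps by blast
  then have "{u, v} \<in> incident_edges (complete_multipartite [1, n, n]) u"
    by (simp add: incident_edges_def)
  then show "incident_edges (complete_multipartite [1, n, n]) u \<noteq> {}"
    by blast
qed

end

theory Submission
  imports Defs "HOL-Number_Theory.Cong"
begin

text \<open>
  The three parts are pairwise adjacent, so three colors are needed. For a labeling with three
  colors, write the labels of the edges between the two large parts as an \<open>n \<times> n\<close> square. The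
  squares \<open>A i j = i - j\<close> and \<open>B i j = 2 * i - j\<close> (modulo the odd number \<open>n\<close>) are orthogonal
  Latin squares, so \<open>2 * n + 1 + n * A i j + B i j\<close> runs through \<open>2 * n + 1, \<dots>, n\<^sup>2 + 2 * n\<close>
  with constant row and column sums. The cells with \<open>A i j = 0\<close> form the diagonal, where
  \<open>B i i = i\<close>. Replacing there \<open>B\<close> by \<open>n - 1 - B\<close> keeps the set of labels and changes the
  \<open>i\<close>-th row sum and the \<open>i\<close>-th column sum by \<open>n - 1 - 2 * i\<close>. The labels \<open>1, \<dots>, 2 * n\<close> on the
  edges at the single vertex compensate for this: the even label \<open>2 * i + 2\<close> completes row \<open>i\<close>,
  the odd label \<open>2 * i + 1\<close> completes column \<open>i\<close>, and row and column sums differ by one.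
\<close>

section \<open>The square\<close>

lemma bij_betw_affine_mod:
  fixes n k c :: nat
  assumes "coprime k n" "n > 0"
  shows "bij_betw (\<lambda>x. (c + k * x) mod n) {..<n} {..<n}"
proof -
  have "inj_on (\<lambda>x. (c + k * x) mod n) {..<n}"
  proof (rule inj_onI)
    fix x y
    assume xy: "x \<in> {..<n}" "y \<in> {..<n}" "(c + k * x) mod n = (c + k * y) mod n"
    then have "[c + k * x = c + k * y] (mod n)"
      by (simp add: cong_def)
    then have "[x = y] (mod n)"
      using assms(1) by (simp add: cong_add_lcancel_nat cong_mult_lcancel_nat)
    then show "x = y"
      using xy by (simp add: cong_def)
  qed
  moreover have "(\<lambda>x. (c + k * x) mod n) ` {..<n} \<subseteq> {..<n}"
    using assms(2) by auto
  ultimately show ?thesis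
    using endo_inj_surj[of "{..<n}"] by (auto simp: bij_betw_def)
qed

lemma sum_affine_mod:
  fixes n k c :: nat
  assumes "coprime k n" "n > 0"
  shows "(\<Sum>x<n. (c + k * x) mod n) = \<Sum>{..<n}"
  using sum.reindex_bij_betw[OF bij_betw_affine_mod[OF assms], of "\<lambda>x. x"] .

lemma affine_mod_surj:
  fixes n k c y :: nat
  assumes "coprime k n" "y < n"
  obtains x where "x < n" "(c + k * x) mod n = y"
proof -
  have "y \<in> (\<lambda>x. (c + k * x) mod n) ` {..<n}"
    using bij_betw_affine_mod[of k n c] assms by (simp add: bij_betw_def)
  then show ?thesis
    using that by auto
qed

text \<open>The factor \<open>n - 1\<close> represents -1 modulo \<open>n\<close>; subtraction of
  naturals would truncate.\<close>

definition latin_A :: "nat \<Rightarrow> nat \<Rightarrow> nat \<Rightarrow> nat" where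
  "latin_A n i j = (i + (n - 1) * j) mod n"

definition latin_B :: "nat \<Rightarrow> nat \<Rightarrow> nat \<Rightarrow> nat" where
  "latin_B n i j = (2 * i + (n - 1) * j) mod n"

definition flipped_B :: "nat \<Rightarrow> nat \<Rightarrow> nat \<Rightarrow> nat" where
  "flipped_B n i j = (if i = j then n - 1 - i else latin_B n i j)"

definition square :: "nat \<Rightarrow> nat \<Rightarrow> nat \<Rightarrow> nat" where
  "square n i j = 2 * n + 1 + n * latin_A n i j + flipped_B n i j"

lemma coprime_pred: "n > 0 \<Longrightarrow> coprime (n - 1) (n :: nat)"
  using coprime_diff_one_left_nat by blast

text \<open>Source of the orthogonality: the two values determine \<open>i\<close> modulo
  \<open>n\<close>, and then \<open>latin_A\<close> determines \<open>j\<close> modulo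
  \<open>n\<close>.\<close>

lemma latin_B_eq: "latin_B n i j = (latin_A n i j + i) mod n"
proof -
  have "2 * i + (n - 1) * j = (i + (n - 1) * j) + i"
    by simp
  then show ?thesis
    unfolding latin_A_def latin_B_def by (simp only: mod_add_left_eq)
qed

lemma latin_A_diag: "n > 0 \<Longrightarrow> latin_A n i i = 0"
proof -
  assume "n > 0"
  then have "i + (n - 1) * i = n * i"
    by (cases n) auto
  then show ?thesis
    by (simp add: latin_A_def)
qed

lemma latin_A_eq_0_iff:
  assumes "i < n" "j < n"
  shows "latin_A n i j = 0 \<longleftrightarrow> i = j"
proof
  assume "latin_A n i j = 0"
  then have "latin_A n i j = latin_A n i i"
    using assms by (simp add: latin_A_diag)
  then show "i = j"
    using bij_betw_imp_inj_on[OF bij_betw_affine_mod[OF coprime_pred, of n i]] assms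
    by (auto simp: latin_A_def dest: inj_onD)
qed (use assms in \<open>simp add: latin_A_diag\<close>)

lemma latin_B_diag: "i < n \<Longrightarrow> latin_B n i i = i"
  by (simp add: latin_B_eq latin_A_diag)

lemma latin_row_sums:
  assumes "n > 0"
  shows "(\<Sum>j<n. latin_A n i j) = \<Sum>{..<n}" "(\<Sum>j<n. latin_B n i j) = \<Sum>{..<n}"
  using sum_affine_mod[OF coprime_pred[OF assms] assms] by (simp_all add: latin_A_def latin_B_def)

text \<open>Down a column \<open>latin_B\<close> advances by 2, which is coprime to \<open>n\<close>
  because \<open>n\<close> is odd.\<close>

lemma latin_column_sums:
  assumes "odd n"
  shows "(\<Sum>i<n. latin_A n i j) = \<Sum>{..<n}" "(\<Sum>i<n. latin_B n i j) = \<Sum>{..<n}"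
proof -
  have "n > 0"
    using assms by (cases n) auto
  then show "(\<Sum>i<n. latin_A n i j) = \<Sum>{..<n}" "(\<Sum>i<n. latin_B n i j) = \<Sum>{..<n}"
    using sum_affine_mod[of 1 n "(n - 1) * j"] sum_affine_mod[of 2 n "(n - 1) * j"] assms
    by (simp_all add: latin_A_def latin_B_def add.commute)
qed

section \<open>Line sums after the diagonal flip\<close>

lemma sum_replace_one:
  fixes g h :: "nat \<Rightarrow> nat"
  assumes "i < n" "\<And>j. j \<noteq> i \<Longrightarrow> h j = g j"
  shows "(\<Sum>j<n. h j) + g i = (\<Sum>j<n. g j) + h i"
proof -
  have "(\<Sum>j\<in>{..<n} - {i}. h j) = (\<Sum>j\<in>{..<n} - {i}. g j)"
    using assms(2) by (intro sum.cong) auto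
  then show ?thesis
    using assms(1) by (simp add: sum.remove[of "{..<n}" i])
qed

text \<open>For positive \<open>n\<close> this is the sum of row 0: the offsets, the two constant
  Latin sums, and the \<open>n - 1\<close> gained by flipping the cell (0, 0).\<close>

definition line_sum :: "nat \<Rightarrow> nat" where
  "line_sum n = n * (2 * n + 1) + n * \<Sum>{..<n} + \<Sum>{..<n} + (n - 1)"

text \<open>The flip trades \<open>i\<close> for \<open>n - 1 - i\<close>. The deficit
  \<open>2 * i\<close> against row 0 is what the label \<open>2 * i + 2\<close> will make
  up.\<close>

lemma square_row_sum:
  assumes "i < n"
  shows "(\<Sum>j<n. square n i j) + 2 * i = line_sum n"
proof -
  have "(\<Sum>j<n. flipped_B n i j) + latin_B n i i = (\<Sum>j<n. latin_B n i j) + flipped_B n i i"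
    using assms by (intro sum_replace_one) (auto simp: flipped_B_def)
  moreover have "flipped_B n i i + i = n - 1"
    using assms by (simp add: flipped_B_def)
  ultimately have "(\<Sum>j<n. flipped_B n i j) + 2 * i = \<Sum>{..<n} + (n - 1)"
    using assms latin_row_sums[of n i] by (simp add: latin_B_diag)
  moreover have "(\<Sum>j<n. square n i j)
      = n * (2 * n + 1) + n * (\<Sum>j<n. latin_A n i j) + (\<Sum>j<n. flipped_B n i j)"
    by (simp add: square_def sum_distrib_left sum.distrib sum_Suc)
  ultimately show ?thesis
    using assms latin_row_sums[of n i] by (simp add: line_sum_def)
qed

lemma square_column_sum:
  assumes "j < n" "odd n"
  shows "(\<Sum>i<n. square n i j) + 2 * j = line_sum n"
proof -
  have "(\<Sum>i<n. flipped_B n i j) + latin_B n j j = (\<Sum>i<n. latin_B n i j) + flipped_B n j j"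
    using assms by (intro sum_replace_one) (auto simp: flipped_B_def)
  moreover have "flipped_B n j j + j = n - 1"
    using assms by (simp add: flipped_B_def)
  ultimately have "(\<Sum>i<n. flipped_B n i j) + 2 * j = \<Sum>{..<n} + (n - 1)"
    using assms latin_column_sums[of n j] by (simp add: latin_B_diag)
  moreover have "(\<Sum>i<n. square n i j)
      = n * (2 * n + 1) + n * (\<Sum>i<n. latin_A n i j) + (\<Sum>i<n. flipped_B n i j)"
    by (simp add: square_def sum_distrib_left sum.distrib sum_Suc)
  ultimately show ?thesis
    using assms latin_column_sums[of n j] by (simp add: line_sum_def)
qed

section \<open>The labels used by the square\<close>

lemma flipped_B_less: "i < n \<Longrightarrow> flipped_B n i j < n"
  by (auto simp: flipped_B_def latin_B_def)

lemma square_bounds: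
  assumes "i < n" "j < n"
  shows "square n i j \<in> {2 * n + 1..n * n + 2 * n}"
proof -
  have "latin_A n i j < n"
    using assms by (simp add: latin_A_def)
  then have "latin_A n i j \<le> n - 1"
    by simp
  then have "n * latin_A n i j \<le> n * (n - 1)"
    by (rule mult_le_mono2)
  then show ?thesis
    using flipped_B_less[OF assms(1), of j] assms
    by (cases n) (auto simp: square_def algebra_simps)
qed

text \<open>The base-\<open>n\<close> digits of \<open>y - (2 * n + 1)\<close> prescribe the entries
  of \<open>latin_A\<close> and \<open>flipped_B\<close>; orthogonality yields the cell.\<close>

lemma square_surj:
  assumes "y \<in> {2 * n + 1..n * n + 2 * n}"
  obtains i j where "i < n" "j < n" "square n i j = y"
proof -
  define z where "z = y - (2 * n + 1)"
  define a where "a = z div n"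
  define b where "b = z mod n"
  \<comment> \<open>The value required of \<open>latin_B\<close>: a leading digit 0 forces a
    diagonal cell, where the flip has to be undone.\<close>
  define b' where "b' = (if a = 0 then n - 1 - b else b)"
  have "n > 0"
    using assms by (cases n) auto
  then have "z < n * n"
    using assms by (auto simp: z_def)
  then have a: "a < n"
    by (simp add: a_def less_mult_imp_div_less)
  have b: "b < n" "b' < n"
    using \<open>n > 0\<close> by (auto simp: b_def b'_def)
  obtain i where i: "i < n" "(a + i) mod n = b'"
    using affine_mod_surj[of 1 n b' a] b by auto
  obtain j where j: "j < n" "latin_A n i j = a"
    using affine_mod_surj[OF coprime_pred a, of i] \<open>n > 0\<close> by (auto simp: latin_A_def)
  have "latin_B n i j = b'"
    using i j by (simp add: latin_B_eq)
  \<comment> \<open>On the diagonal the flip then gives \<open>n - 1 - b'\<close>, which is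
    \<open>b\<close>.\<close>
  moreover have "i = b'" if "a = 0"
    using i that by simp
  ultimately have "flipped_B n i j = b"
    using latin_A_eq_0_iff[OF i(1) j(1)] j(2) b by (auto simp: flipped_B_def b'_def)
  then have "square n i j = 2 * n + 1 + z"
    using j by (simp add: square_def a_def b_def)
  then have "square n i j = y"
    using assms by (simp add: z_def)
  then show ?thesis
    using that i j by blast
qed

section \<open>The labeling\<close>

definition K1 :: "nat \<Rightarrow> (nat \<times> nat) ugraph" where
  "K1 n = complete_multipartite [1, n, n]"

lemma vertices_K1:
  "vertices (K1 n) = insert (0, 0) (Pair 1 ` {..<n} \<union> Pair 2 ` {..<n})"
  by (auto simp: K1_def complete_multipartite_def Let_def less_Suc_eq numeral_3_eq_3 numeral_2_eq_2)

lemma doubleton_in_edge_set_iff: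
  "{u, v} \<in> {{u, v} | u v. u \<in> V \<and> v \<in> V \<and> fst u \<noteq> fst v}
    \<longleftrightarrow> u \<in> V \<and> v \<in> V \<and> fst u \<noteq> fst v" (is "?L \<longleftrightarrow> ?R")
proof
  assume ?L
  then obtain u' v' where "{u, v} = {u', v'}" "u' \<in> V" "v' \<in> V" "fst u' \<noteq> fst v'"
    by blast
  then show ?R
    by (metis doubleton_eq_iff)
qed blast

lemma edge_K1_iff:
  "{u, v} \<in> edges (K1 n) \<longleftrightarrow> u \<in> vertices (K1 n) \<and> v \<in> vertices (K1 n) \<and> fst u \<noteq> fst v"
  unfolding K1_def complete_multipartite_def Let_def ugraph.simps
  by (rule doubleton_in_edge_set_iff)

lemma edges_K1:
  "edges (K1 n) = (\<lambda>i. {(0, 0), (1, i)}) ` {..<n} \<union> (\<lambda>j. {(0, 0), (2, j)}) ` {..<n}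
     \<union> (\<lambda>(i, j). {(1, i), (2, j)}) ` ({..<n} \<times> {..<n})" (is "_ = ?R")
proof
  show "edges (K1 n) \<subseteq> ?R"
  proof
    fix e assume e: "e \<in> edges (K1 n)"
    then obtain u v where uv: "e = {u, v}"
      unfolding K1_def complete_multipartite_def Let_def by auto
    show "e \<in> ?R"
      using e unfolding uv edge_K1_iff vertices_K1 by (auto simp: insert_commute image_iff)
  qed
  show "?R \<subseteq> edges (K1 n)"
    by (auto simp: edge_K1_iff vertices_K1)
qed

lemma incident_edges_K1:
  "incident_edges (K1 n) (0, 0) =
     (\<lambda>i. {(0, 0), (1, i)}) ` {..<n} \<union> (\<lambda>j. {(0, 0), (2, j)}) ` {..<n}"
  "i < n \<Longrightarrow> incident_edges (K1 n) (1, i) =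
     insert {(0, 0), (1, i)} ((\<lambda>j. {(1, i), (2, j)}) ` {..<n})"
  "j < n \<Longrightarrow> incident_edges (K1 n) (2, j) =
     insert {(0, 0), (2, j)} ((\<lambda>i. {(1, i), (2, j)}) ` {..<n})"
  by (auto simp: incident_edges_def edges_K1)

text \<open>Edges are unordered, so an end is identified by its part; it is unique because an edge
  meets each part at most once.\<close>

definition part_index :: "nat \<Rightarrow> (nat \<times> nat) set \<Rightarrow> nat" where
  "part_index k e = (THE j. (k, j) \<in> e)"

definition labeling :: "nat \<Rightarrow> (nat \<times> nat) set \<Rightarrow> nat" where
  "labeling n e =
     (if (0, 0) \<notin> e then square n (part_index 1 e) (part_index 2 e)
      else if \<exists>i. (1, i) \<in> e then 2 * part_index 1 e + 2
      else 2 * part_index 2 e + 1)"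

lemma labeling_simps [simp]:
  "labeling n {(0, 0), (Suc 0, i)} = 2 * i + 2"
  "labeling n {(0, 0), (2, j)} = 2 * j + 1"
  "labeling n {(Suc 0, i), (2, j)} = square n i j"
  by (auto simp: labeling_def part_index_def)

section \<open>Vertex weights\<close>

lemma sum_pair_images:
  fixes g :: "(nat \<times> nat) set \<Rightarrow> nat"
  shows "sum g ((\<lambda>x. {u, (k, x)}) ` A) = (\<Sum>x\<in>A. g {u, (k, x)})"
    and "sum g ((\<lambda>x. {(k, x), u}) ` A) = (\<Sum>x\<in>A. g {(k, x), u})"
  by (rule sum.reindex_cong[OF _ refl refl]; force simp: inj_on_def doubleton_eq_iff)+

text \<open>The value is 1 + ... + 2n = n(2n + 1), written through \<open>\<Sum>{..<n}\<close> for
  the comparison with \<open>line_sum n\<close>.\<close>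

lemma weight_labeling_apex:
  "weight (K1 n) (labeling n) (0, 0) = 4 * \<Sum>{..<n} + 3 * n"
proof -
  have "weight (K1 n) (labeling n) (0, 0) = sum (labeling n) ((\<lambda>i. {(0, 0), (1, i)}) ` {..<n})
      + sum (labeling n) ((\<lambda>j. {(0, 0), (2, j)}) ` {..<n})"
    unfolding weight_def incident_edges_K1(1)
    by (rule sum.union_disjoint) (simp_all add: disjoint_iff_not_equal doubleton_eq_iff)
  also have "\<dots> = (\<Sum>i<n. 2 * i + 2) + (\<Sum>j<n. 2 * j + 1)"
    by (simp add: sum_pair_images)
  also have "\<dots> = 4 * \<Sum>{..<n} + 3 * n"
    by (induction n) auto
  finally show ?thesis .
qed

lemma weight_labeling_row:
  assumes "i < n"
  shows "weight (K1 n) (labeling n) (1, i) = line_sum n + 2"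
proof -
  have "weight (K1 n) (labeling n) (1, i)
      = labeling n {(0, 0), (1, i)} + sum (labeling n) ((\<lambda>j. {(1, i), (2, j)}) ` {..<n})"
    unfolding weight_def incident_edges_K1(2)[OF assms]
    by (rule sum.insert) (simp_all add: image_iff doubleton_eq_iff)
  also have "\<dots> = (2 * i + 2) + (\<Sum>j<n. square n i j)"
    by (simp add: sum_pair_images)
  finally show ?thesis
    using square_row_sum[OF assms] by simp
qed

lemma weight_labeling_column:
  assumes "j < n" "odd n"
  shows "weight (K1 n) (labeling n) (2, j) = line_sum n + 1"
proof -
  have "weight (K1 n) (labeling n) (2, j)
      = labeling n {(0, 0), (2, j)} + sum (labeling n) ((\<lambda>i. {(1, i), (2, j)}) ` {..<n})"
    unfolding weight_def incident_edges_K1(3)[OF assms(1)]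
    by (rule sum.insert) (simp_all add: image_iff doubleton_eq_iff)
  also have "\<dots> = (2 * j + 1) + (\<Sum>i<n. square n i j)"
    by (simp add: sum_pair_images)
  finally show ?thesis
    using square_column_sum[OF assms] by simp
qed

lemma apex_weight_less:
  assumes "n \<ge> 3"
  shows "4 * \<Sum>{..<n} + 3 * n < line_sum n + 1"
proof -
  \<comment> \<open>Lowering the factor \<open>n\<close> to 3 in both products bounds
    \<open>line_sum n\<close> below by \<open>4 * \<Sum>{..<n} + 7 * n + 2\<close>.\<close>
  have "3 * \<Sum>{..<n} \<le> n * \<Sum>{..<n}" "3 * (2 * n + 1) \<le> n * (2 * n + 1)"
    using assms by (intro mult_le_mono1; simp)+
  moreover have "3 * (2 * n + 1) = 6 * n + 3"
    by simp
  ultimately show ?thesis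
    using assms unfolding line_sum_def by linarith
qed

section \<open>Bijectivity by counting\<close>

lemma card_edges_K1_le: "card (edges (K1 n)) \<le> n * n + 2 * n"
proof -
  have "card (edges (K1 n)) \<le> n + n + n * n"
    unfolding edges_K1
    by (intro order.trans[OF card_Un_le] add_mono order.trans[OF card_image_le]) auto
  then show ?thesis
    by simp
qed

lemma labeling_image: "labeling n ` edges (K1 n) = {1..n * n + 2 * n}"
proof
  show "labeling n ` edges (K1 n) \<subseteq> {1..n * n + 2 * n}"
    using square_bounds[of _ n] by (fastforce simp: edges_K1)
  show "{1..n * n + 2 * n} \<subseteq> labeling n ` edges (K1 n)"
  proof
    fix y assume y: "y \<in> {1..n * n + 2 * n}"
    consider "y \<le> 2 * n" "even y" | "y \<le> 2 * n" "odd y" | "y > 2 * n"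
      by linarith
    then show "y \<in> labeling n ` edges (K1 n)"
    proof cases
      case 1
      then obtain i where "y = 2 * i" by blast
      \<comment> \<open>Even labels start at 2, so \<open>y = 2 * i\<close> sits at index
        \<open>i - 1\<close>; here \<open>i\<close> is positive because \<open>y\<close> is.\<close>
      with 1 y have "{(0, 0), (1, i - 1)} \<in> edges (K1 n)" "y = labeling n {(0, 0), (1, i - 1)}"
        by (auto simp: edges_K1)
      then show ?thesis
        by blast
    next
      case 2
      then obtain j where "y = 2 * j + 1" by (auto elim: oddE)
      with 2 have "{(0, 0), (2, j)} \<in> edges (K1 n)" "y = labeling n {(0, 0), (2, j)}"
        by (auto simp: edges_K1)
      then show ?thesis
        by blast
    next
      case 3
      with y obtain i j where "i < n" "j < n" "square n i j = y"
        by (auto intro: square_surj[of y n])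
      then have "{(1, i), (2, j)} \<in> edges (K1 n)" "y = labeling n {(1, i), (2, j)}"
        by (auto simp: edges_K1)
      then show ?thesis
        by blast
    qed
  qed
qed

text \<open>The image has \<open>n * n + 2 * n\<close> elements and there are at most that many
  edges, so the labeling is injective.\<close>

lemma bij_betw_labeling: "bij_betw (labeling n) (edges (K1 n)) {1..card (edges (K1 n))}"
proof -
  have fin: "finite (edges (K1 n))"
    by (simp add: edges_K1)
  have card: "card (edges (K1 n)) = n * n + 2 * n"
    using card_image_le[OF fin, of "labeling n"] card_edges_K1_le[of n]
    by (simp add: labeling_image)
  then have "inj_on (labeling n) (edges (K1 n))"
    using fin by (intro eq_card_imp_inj_on) (simp_all add: labeling_image)
  then show ?thesis
    by (simp add: bij_betw_def labeling_image card)
qed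

lemma local_antimagic_labeling_K1:
  assumes "n \<ge> 3" "odd n"
  shows "local_antimagic_labeling (K1 n) (labeling n)"
  unfolding local_antimagic_labeling_def
proof (intro conjI allI impI bij_betw_labeling)
  fix u v assume "{u, v} \<in> edges (K1 n)"
  then show "weight (K1 n) (labeling n) u \<noteq> weight (K1 n) (labeling n) v"
    unfolding edge_K1_iff vertices_K1
    using apex_weight_less[OF assms(1)] weight_labeling_row weight_labeling_column[OF _ assms(2)]
    by (auto simp: weight_labeling_apex)
qed

lemma card_labeling_weights_le:
  assumes "odd n"
  shows "card (weight (K1 n) (labeling n) ` vertices (K1 n)) \<le> 3"
proof -
  have "weight (K1 n) (labeling n) ` vertices (K1 n)
      \<subseteq> {4 * \<Sum>{..<n} + 3 * n, line_sum n + 2, line_sum n + 1}" (is "_ \<subseteq> ?W")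
    using weight_labeling_row weight_labeling_column[OF _ assms]
    by (auto simp: vertices_K1 weight_labeling_apex)
  then have "card (weight (K1 n) (labeling n) ` vertices (K1 n)) \<le> card ?W"
    by (intro card_mono) auto
  also have "\<dots> \<le> 3"
    by (simp add: card_insert_if)
  finally show ?thesis .
qed

section \<open>The lower bound and the conclusion\<close>

lemma card_weights_K1_ge:
  assumes "n \<ge> 1" "local_antimagic_labeling (K1 n) f"
  shows "3 \<le> card (weight (K1 n) f ` vertices (K1 n))"
proof -
  let ?w = "weight (K1 n) f"
  \<comment> \<open>The first vertices of the three parts form a triangle.\<close>
  have "{(0, 0), (1, 0)} \<in> edges (K1 n)" "{(0, 0), (2, 0)} \<in> edges (K1 n)"
    "{(1, 0), (2, 0)} \<in> edges (K1 n)"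
    using assms(1) by (auto simp: edges_K1)
  then have "?w (0, 0) \<noteq> ?w (1, 0)" "?w (0, 0) \<noteq> ?w (2, 0)" "?w (1, 0) \<noteq> ?w (2, 0)"
    using assms(2) unfolding local_antimagic_labeling_def by blast+
  then have "3 = card (?w ` {(0, 0), (1, 0), (2, 0)})"
    by simp
  also have "\<dots> \<le> card (?w ` vertices (K1 n))"
    using assms(1) by (intro card_mono image_mono) (auto simp: vertices_K1)
  finally show ?thesis .
qed

theorem theorem2p8:
  fixes n :: nat
  assumes "n \<ge> 3" and "odd n"
  shows "local_antimagic_chromatic_number (complete_multipartite [1, n, n]) = 3"
  unfolding K1_def[symmetric]
proof (rule antisym)
  have "local_antimagic_chromatic_number (K1 n)
      \<le> enat (card (weight (K1 n) (labeling n) ` vertices (K1 n)))"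
    unfolding local_antimagic_chromatic_number_def
    using local_antimagic_labeling_K1[OF assms] by (intro INF_lower) simp
  also have "\<dots> \<le> 3"
    using card_labeling_weights_le[OF assms(2)] by (simp add: numeral_eq_enat)
  finally show "local_antimagic_chromatic_number (K1 n) \<le> 3" .
  show "3 \<le> local_antimagic_chromatic_number (K1 n)"
    unfolding local_antimagic_chromatic_number_def
    using card_weights_K1_ge[of n] assms(1)
    by (intro INF_greatest) (auto simp: numeral_eq_enat)
qed

end
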